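(* Let $m\in\mathbb{N}$ and suppose that $f(x)=\min_{1\leq i\leq m}f_i(x)$ is continuous on $\operatorname{dom}\partial f$, where $f_i:\mathbb{R}^n\to\overline{\mathbb{R}}$ is a proper and lsc function for each $i\in\{1,\ldots,m\}$. Let $\bar{x}\in\operatorname{dom}\partial f$, let $I(\bar{x})=\{i\in\{1,\ldots,m\}:f_i(\bar{x})=f(\bar{x})\}$, and suppose that $\bar{x}\in\bigcap_{i\in I(\bar{x})}\operatorname{dom}\partial f_i$. Assume further that for every $i\in I(\bar{x})$, the function $f_i$ has the generalized concave KL property at $\bar{x}$ with respect to $U_i=\mathbb{B}(\bar{x};\varepsilon_i)$ for some $\varepsilon_i>0$, $\eta_i>0$ and $\varphi_i\in\Phi_{\eta_i}$. Set $\eta=\min_{i\in I(\bar{x})}\eta_i$ and define $\varphi:[0,\eta)\to\overline{\mathbb{R}}$ by $\varphi(0)=0$ and $$\varphi(t)=\int_0^t\max_{i\in I(\bar{x})}(\varphi_i)'_-(s)\,ds,\qquad 0<t<\eta.$$ Then there exists $\varepsilon>0$ such that $f$ has the generalized concave KL property at $\bar{x}$ with respect to $U=\mathbb{B}(\bar{x};\varepsilon)$, $\eta$ and $\varphi$.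
   Context: Notation. $\overline{\mathbb{R}}=(-\infty,\infty]$, $\mathbb{R}_+=[0,\infty)$, $\|\cdot\|$ is the Euclidean norm, $\mathbb{B}(\bar{x};r)$ is the open ball of center $\bar x$ and radius $r$. $\operatorname{dist}(x,K)=\inf\{\|x-y\|:y\in K\}$, with $\operatorname{dist}(x,\varnothing)=\infty$. For $f:\mathbb{R}^n\to\overline{\mathbb{R}}$, $[r_1<f<r_2]=\{x\in\mathbb{R}^n:r_1<f(x)<r_2\}$. "lsc" means lower semicontinuous. Left derivative. $\varphi'_-(t)=\lim_{s\to t^-}\frac{\varphi(s)-\varphi(t)}{s-t}$. Subdifferential. Let $f:\mathbb{R}^n\to\overline{\mathbb{R}}$ be proper. For $\bar x\in\operatorname{dom}f$, $v$ is a Fréchet subgradient of $f$ at $\bar x$, $v\in\hat\partial f(\bar x)$, if $f(x)\ge f(\bar x)+\langle v,x-\bar x\rangle+o(\|x-\bar x\|)$ for every $x\in\operatorname{dom}f$. The limiting subdifferential is $\partial f(\bar x)=\{u:\exists x_k\to\bar x \text{ with } f(x_k)\to f(\bar x),\ \exists u_k\in\hat\partial f(x_k),\ u_k\to u\}$. $\operatorname{dom}\partial f=\{x:\partial f(x)\neq\varnothing\}$. The class $\Phi_\eta$. For $\eta\in(0,\infty]$, $\Phi_\eta$ is the class of functions $\varphi:[0,\eta)\to\mathbb{R}_+$ that are right-continuous at $0$ with $\varphi(0)=0$ and strictly increasing on $[0,\eta)$. Generalized concave KL (Kurdyka-Łojasiewicz) property. Let $f:\mathbb{R}^n\to\overline{\mathbb{R}}$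 be proper lsc and $\bar x\in\operatorname{dom}\partial f$. Given a neighborhood $U$ of $\bar x$, $\eta\in(0,\infty]$ and a concave $\varphi\in\Phi_\eta$, $f$ has the generalized concave KL property at $\bar x$ with respect to $U$, $\eta$ and $\varphi$ if for all $x\in U\cap[0<f-f(\bar x)<\eta]$, $$\varphi'_-\big(f(x)-f(\bar x)\big)\cdot\operatorname{dist}\big(0,\partial f(x)\big)\geq 1.$$ In particular, saying that the property holds with respect to $\varphi$ includes that $\varphi$ is concave and $\varphi\in\Phi_\eta$. *)

theory Defs
  imports "HOL-Analysis.Analysis" "HOL-Library.Landau_Symbols"
begin

(* Functions f : R^n -> (-infinity, infinity] are rendered as ereal-valued functions;
   the exclusion of the value -infinity is part of proper_fun. *)

definition edom :: "('a \<Rightarrow> ereal) \<Rightarrow> 'a set" where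
  "edom f = {x. f x < \<infinity>}"

definition proper_fun :: "('a \<Rightarrow> ereal) \<Rightarrow> bool" where
  "proper_fun f \<longleftrightarrow> (\<forall>x. f x \<noteq> -\<infinity>) \<and> edom f \<noteq> {}"

definition lsc_fun :: "('a::topological_space \<Rightarrow> ereal) \<Rightarrow> bool" where
  "lsc_fun f \<longleftrightarrow> (\<forall>x. f x \<le> Liminf (at x) f)"

(* setdist and infdist return 0 for the empty set, whereas here dist(x, {}) = infinity. *)
definition edist_set :: "'a::real_normed_vector \<Rightarrow> 'a set \<Rightarrow> ereal" where
  "edist_set x K = (INF y\<in>K. ereal (norm (x - y)))"

(* r is the remainder o(norm (y - x)) as y tends to x. *)
definition frechet_subdiff :: "('a::real_inner \<Rightarrow> ereal) \<Rightarrow> 'a \<Rightarrow> 'a set" where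
  "frechet_subdiff f x = {v. x \<in> edom f \<and>
     (\<exists>r :: 'a \<Rightarrow> real. r \<in> o[at x](\<lambda>y. norm (y - x)) \<and>
        (\<forall>y\<in>edom f. f y \<ge> f x + ereal (v \<bullet> (y - x) + r y)))}"

definition limiting_subdiff :: "('a::real_inner \<Rightarrow> ereal) \<Rightarrow> 'a \<Rightarrow> 'a set" where
  "limiting_subdiff f x = {u. x \<in> edom f \<and>
     (\<exists>(X :: nat \<Rightarrow> 'a) (V :: nat \<Rightarrow> 'a).
        X \<longlonglongrightarrow> x \<and> (\<lambda>k. f (X k)) \<longlonglongrightarrow> f x \<and>
        (\<forall>k. V k \<in> frechet_subdiff f (X k)) \<and> V \<longlonglongrightarrow> u)}"

definition dom_subdiff :: "('a::real_inner \<Rightarrow> ereal) \<Rightarrow> 'a set" where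
  "dom_subdiff f = {x. limiting_subdiff f x \<noteq> {}}"

(* Used only for concave phi at interior points of its domain, where the limit exists. *)
definition left_deriv :: "(real \<Rightarrow> real) \<Rightarrow> real \<Rightarrow> real" where
  "left_deriv \<phi> t = Lim (at_left t) (\<lambda>s. (\<phi> s - \<phi> t) / (s - t))"

(* The interval [0, eta) with eta possibly infinite. *)
definition Ico0 :: "ereal \<Rightarrow> real set" where
  "Ico0 \<eta> = {t. 0 \<le> t \<and> ereal t < \<eta>}"

(* A function on [0, eta) is a total function on the reals; its values outside [0, eta)
   are irrelevant. *)
definition Phi_class :: "ereal \<Rightarrow> (real \<Rightarrow> real) set" where
  "Phi_class \<eta> = {\<phi>. (\<forall>t\<in>Ico0 \<eta>. 0 \<le> \<phi> t) \<and> (\<phi> \<longlongrightarrow> \<phi> 0) (at_right 0) \<and> \<phi> 0 = 0 \<and>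
     strict_mono_on (Ico0 \<eta>) \<phi>}"

definition gen_concave_KL ::
  "('a::real_inner \<Rightarrow> ereal) \<Rightarrow> 'a \<Rightarrow> 'a set \<Rightarrow> ereal \<Rightarrow> (real \<Rightarrow> real) \<Rightarrow> bool" where
  "gen_concave_KL f xbar U \<eta> \<phi> \<longleftrightarrow>
     proper_fun f \<and> lsc_fun f \<and> xbar \<in> dom_subdiff f \<and> xbar \<in> interior U \<and>
     0 < \<eta> \<and> \<phi> \<in> Phi_class \<eta> \<and> concave_on (Ico0 \<eta>) \<phi> \<and>
     (\<forall>x\<in>U. 0 < f x - f xbar \<and> f x - f xbar < \<eta> \<longrightarrow>
        ereal (left_deriv \<phi> (real_of_ereal (f x - f xbar))) * edist_set 0 (limiting_subdiff f x)
          \<ge> 1)"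

end

theory Submission
  imports Defs
begin

text \<open>
  Near \<open>xbar\<close>, at points of \<open>dom_subdiff f\<close>, only pieces of the minimum that are active at
  \<open>xbar\<close> can be active: an inactive piece stays above some level \<open>d > f xbar\<close> by lower
  semicontinuity, while \<open>f\<close> stays below \<open>d\<close> by continuity on \<open>dom_subdiff f\<close>
  (\<open>eventually_active_subset\<close>). Moreover every limiting subgradient of the minimum is a limiting
  subgradient of a piece active at the same point (\<open>limiting_subdiff_Min\<close>). So each
  \<open>u \<in> limiting_subdiff f x\<close> comes from some \<open>i \<in> I\<close> with \<open>fi i x - fi i xbar = f x - f xbar\<close>,
  and the inequality assumed for that piece bounds \<open>norm u\<close> from below in terms of
  \<open>left_deriv (\<phi>i i)\<close> at this common value.

  It remains to compare the left derivative of the integral \<open>\<phi>\<close> with the integrand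
  \<open>h = (MAX i\<in>I. left_deriv (\<phi>i i))\<close>. Left derivatives of concave functions decrease, and so
  does their maximum; hence the average of \<open>h\<close> over \<open>{s..t}\<close> lies between \<open>h t\<close> and \<open>h s\<close>. As
  \<open>h\<close> is positive, these two bounds make \<open>\<phi>\<close> concave and strictly increasing, and they give
  \<open>h t \<le> left_deriv \<phi> t\<close>, the direction in which the two are compared
  (\<open>integral_from_0_concave_Phi\<close>).

  The integrand may be unbounded at \<open>0\<close>, so finiteness of \<open>\<phi>\<close> and its continuity at \<open>0\<close> need an
  argument. Comparing \<open>h\<close> on dyadic intervals with increments of \<open>\<Sum>i\<in>I. \<phi>i i\<close> bounds \<open>\<phi> t\<close> by
  twice the value of that sum at \<open>t\<close> (\<open>integral_from_0_le\<close>).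
\<close>

section \<open>Subdifferentials of a minimum\<close>

text \<open>The punctured neighbourhoods in the definition may be replaced by full ones, since the
  inequality \<open>c < f y\<close> is trivial at \<open>y = x\<close>; sequences that hit their limit are then covered.\<close>

lemma lsc_fun_iff:
  "lsc_fun f \<longleftrightarrow> (\<forall>x c. c < f x \<longrightarrow> (\<forall>\<^sub>F y in nhds x. c < f y))"
  unfolding lsc_fun_def le_Liminf_iff eventually_nhds_conv_at by blast

lemma lsc_fun_Min:
  assumes "finite J" "J \<noteq> {}" "\<And>i. i \<in> J \<Longrightarrow> lsc_fun (g i)"
  shows "lsc_fun (\<lambda>x. MIN i\<in>J. g i x)"
  unfolding lsc_fun_iff
proof (intro allI impI)
  fix x c assume "c < (MIN i\<in>J. g i x)"
  then have "\<forall>i\<in>J. \<forall>\<^sub>F y in nhds x. c < g i y"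
    using assms by (auto simp: lsc_fun_iff)
  then have "\<forall>\<^sub>F y in nhds x. \<forall>i\<in>J. c < g i y"
    using assms(1) by (simp add: eventually_ball_finite)
  then show "\<forall>\<^sub>F y in nhds x. c < (MIN i\<in>J. g i y)"
    by eventually_elim (use assms in auto)
qed

lemma frechet_subdiff_mono:
  assumes "\<And>y. f y \<le> g y" and "f x = g x"
  shows "frechet_subdiff f x \<subseteq> frechet_subdiff g x"
proof -
  have "edom g \<subseteq> edom f"
    unfolding edom_def using assms(1) by (blast intro: le_less_trans)
  then show ?thesis
    unfolding frechet_subdiff_def
    using assms by (smt (verit) edom_def mem_Collect_eq order_trans subset_iff)
qed

text \<open>At a point where \<open>g i\<close> is active, \<open>f\<close> is a minorant of \<open>g i\<close> touching it, so Frechet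
  subgradients of \<open>f\<close> pass to \<open>g i\<close>. Since there are finitely many pieces, one of them is active
  along a subsequence of the approximating points. Lower semicontinuity then forces this piece to be
  active at the limit as well, which also gives the convergence of values that the limiting
  subdifferential of \<open>g i\<close> requires.\<close>

lemma limiting_subdiff_Min:
  assumes J: "finite J" "J \<noteq> {}" and lsc: "\<And>i. i \<in> J \<Longrightarrow> lsc_fun (g i)"
    and f: "\<And>x. f x = (MIN i\<in>J. g i x)"
    and u: "u \<in> limiting_subdiff f x"
  obtains i where "i \<in> J" "g i x = f x" "u \<in> limiting_subdiff (g i) x"
proof -
  obtain X V where X: "X \<longlonglongrightarrow> x" and fX: "(\<lambda>k. f (X k)) \<longlonglongrightarrow> f x"
    and V: "\<And>k. V k \<in> frechet_subdiff f (X k)" "V \<longlonglongrightarrow> u" and x: "x \<in> edom f"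
    using u unfolding limiting_subdiff_def by blast
  have le: "f y \<le> g i y" if "i \<in> J" for i y
    using that J by (simp add: f)
  have "\<exists>i\<in>J. f (X k) = g i (X k)" for k
  proof -
    have "f (X k) \<in> (\<lambda>i. g i (X k)) ` J" unfolding f using J by (intro Min_in) auto
    then show ?thesis by blast
  qed
  then obtain c where c: "\<And>k. c k \<in> J" "\<And>k. f (X k) = g (c k) (X k)"
    by metis
  \<comment> \<open>One piece is active at infinitely many of the approximating points.\<close>
  obtain k0 where "infinite {k. c k = c k0}"
    using pigeonhole_infinite[of UNIV c] finite_subset[OF _ J(1), of "range c"] c(1)
    by (auto simp: image_subset_iff)
  then obtain r where r: "strict_mono (r :: nat \<Rightarrow> nat)" and rc: "\<And>k. c (r k) = c k0"
    using infinite_enumerate[of "{k. c k = c k0}"] by auto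
  define i where "i = c k0"
  have i: "i \<in> J" and fg: "f (X (r k)) = g i (X (r k))" for k
    using c[of "r k"] rc by (auto simp: i_def)
  have Xr: "(\<lambda>k. X (r k)) \<longlonglongrightarrow> x" and Vr: "(\<lambda>k. V (r k)) \<longlonglongrightarrow> u"
    and fr: "(\<lambda>k. f (X (r k))) \<longlonglongrightarrow> f x"
    using LIMSEQ_subseq_LIMSEQ[OF _ r] X V(2) fX by (auto simp: o_def)
  have eq: "g i x = f x"
  proof (rule antisym[OF _ le[OF i]], rule ccontr)
    assume "\<not> g i x \<le> f x"
    then obtain d where d: "f x < d" "d < g i x"
      by (meson dense not_le)
    have "\<forall>\<^sub>F k in sequentially. d < g i (X (r k))"
      using lsc[OF i] d(2) Xr unfolding lsc_fun_iff filterlim_iff by blast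
    moreover have "\<forall>\<^sub>F k in sequentially. f (X (r k)) < d"
      using order_tendstoD(2)[OF fr d(1)] .
    ultimately have "\<forall>\<^sub>F k in sequentially. False"
      by eventually_elim (simp add: fg)
    then show False by simp
  qed
  have "V (r k) \<in> frechet_subdiff (g i) (X (r k))" for k
    using frechet_subdiff_mono[of f "g i" "X (r k)"] le[OF i] fg V(1) by blast
  then have "u \<in> limiting_subdiff (g i) x"
    unfolding limiting_subdiff_def using Xr Vr fr x eq fg
    by (intro CollectI conjI exI[of _ "\<lambda>k. X (r k)"] exI[of _ "\<lambda>k. V (r k)"])
      (auto simp: edom_def)
  then show thesis using that i eq by blast
qed

text \<open>Passing to \<open>1 / c \<le> edist_set x K\<close> avoids multiplying an infimum and covers \<open>K = {}\<close>, where
  the distance is infinite.\<close>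

lemma one_le_mult_edist_set:
  assumes "0 < c" "\<And>u. u \<in> K \<Longrightarrow> 1 \<le> c * norm (x - u)"
  shows "1 \<le> ereal c * edist_set x K"
proof -
  have "ereal (1 / c) \<le> edist_set x K"
    unfolding edist_set_def
    by (intro INF_greatest) (use assms in \<open>auto simp: field_simps\<close>)
  then have "ereal c * ereal (1 / c) \<le> ereal c * edist_set x K"
    using assms(1) by (intro ereal_mult_left_mono) auto
  then show ?thesis using assms(1) by (simp add: one_ereal_def)
qed

lemma edist_set_le: "u \<in> K \<Longrightarrow> edist_set x K \<le> ereal (norm (x - u))"
  unfolding edist_set_def by (rule INF_lower)

section \<open>Left derivatives of concave functions\<close>

lemma convex_Ico0: "convex (Ico0 \<eta>)"
proof (cases \<eta>)
  case (real r)
  then have "Ico0 \<eta> = {0..<r}" by (auto simp: Ico0_def)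
  then show ?thesis by simp
next
  case PInf
  then have "Ico0 \<eta> = {0..}" by (auto simp: Ico0_def)
  then show ?thesis by simp
next
  case MInf
  then have "Ico0 \<eta> = {}" by (auto simp: Ico0_def)
  then show ?thesis by simp
qed

lemma Ico0_mono: "\<lbrakk>t \<in> Ico0 \<eta>; 0 \<le> s; s \<le> t\<rbrakk> \<Longrightarrow> s \<in> Ico0 \<eta>"
  by (auto simp: Ico0_def intro: le_less_trans[of "ereal s" "ereal t"])

lemma Ico0_open_right:
  assumes "t \<in> Ico0 \<eta>"
  obtains t' where "t < t'" "t' \<in> Ico0 \<eta>"
proof -
  obtain t' where "ereal t < ereal t'" "ereal t' < \<eta>"
    using ereal_dense2[of "ereal t" \<eta>] assms by (auto simp: Ico0_def)
  then show thesis using assms by (intro that[of t']) (auto simp: Ico0_def)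
qed

lemma concave_on_slopes:
  fixes G :: "real \<Rightarrow> real"
  assumes "concave_on S G" "a \<in> S" "c \<in> S" "a < b" "b < c"
  shows "(G c - G b) / (c - b) \<le> (G c - G a) / (c - a)"
    and "(G c - G a) / (c - a) \<le> (G b - G a) / (b - a)"
  using convex_on_slope_le[of S "\<lambda>x. - G x" a c b] assms
  by (auto simp: concave_on_def field_simps)

lemma concave_on_realI:
  fixes G :: "real \<Rightarrow> real"
  assumes S: "convex S"
    and sl: "\<And>a b c. \<lbrakk>a \<in> S; b \<in> S; c \<in> S; a < b; b < c\<rbrakk> \<Longrightarrow>
           (G c - G b) * (b - a) \<le> (G b - G a) * (c - b)"
  shows "concave_on S G"
proof (rule concave_on_linorderI[OF _ S])
  fix t x y :: real assume t: "0 < t" "t < 1" and xy: "x \<in> S" "y \<in> S" "x < y"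
  define b where "b = (1 - t) * x + t * y"
  have d: "b - x = t * (y - x)" "y - b = (1 - t) * (y - x)"
    by (simp_all add: b_def algebra_simps)
  have "x < b" "b < y" using d t xy by (smt (verit) mult_pos_pos)+
  moreover have "b \<in> S"
    using S t xy unfolding convex_def b_def by (metis add.commute diff_add_cancel diff_ge_0_iff_ge less_imp_le real_scaleR_def)
  ultimately have "(G y - G b) * (b - x) \<le> (G b - G x) * (y - b)"
    using sl xy by blast
  then have "((G y - G b) * t) * (y - x) \<le> ((G b - G x) * (1 - t)) * (y - x)"
    unfolding d by (simp add: algebra_simps)
  then have "(G y - G b) * t \<le> (G b - G x) * (1 - t)"
    using xy by simp
  then have "(1 - t) * G x + t * G y \<le> G b" by (simp add: algebra_simps)
  then show "(1 - t) * G x + t * G y \<le> G ((1 - t) *\<^sub>R x + t *\<^sub>R y)"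
    by (simp add: b_def)
qed

text \<open>The defining limit exists because the slopes of the chords from \<open>s\<close> to \<open>t\<close> decrease as
  \<open>s\<close> increases to \<open>t\<close>, and they are bounded below by the slope of a chord to the right of \<open>t\<close>.
  Such a chord exists since \<open>Ico0 \<eta>\<close> has no largest element.\<close>

lemma left_deriv_tendsto:
  assumes conc: "concave_on (Ico0 \<eta>) G" and t: "0 < t" "t \<in> Ico0 \<eta>"
  shows "((\<lambda>s. (G s - G t) / (s - t)) \<longlongrightarrow> left_deriv G t) (at_left t)"
proof -
  define q where "q s = (G t - G s) / (t - s)" for s
  have q: "q = (\<lambda>s. (G s - G t) / (s - t))"
  proof
    show "q s = (G s - G t) / (s - t)" for s
      using minus_divide_divide[of "G t - G s" "t - s"] by (simp add: q_def)
  qed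
  define l where "l = Inf (q ` {0<..<t})"
  obtain t' where t': "t < t'" "t' \<in> Ico0 \<eta>" using Ico0_open_right[OF t(2)] .
  have S: "s \<in> Ico0 \<eta>" if "0 < s" "s < t" for s
    using Ico0_mono[OF t(2)] that by simp
  have "(G t' - G t) / (t' - t) \<le> q s" if "s \<in> {0<..<t}" for s
    using concave_on_slopes[OF conc S t'(2), of s t] t'(1) that by (auto simp: q_def)
  then have bdd: "bdd_below (q ` {0<..<t})" by (rule bdd_belowI2)
  have "(q \<longlongrightarrow> l) (at_left t)"
  proof (rule decreasing_tendsto)
    show "\<forall>\<^sub>F s in at_left t. l \<le> q s"
      using eventually_at_left_real[OF t(1)]
      by eventually_elim (use bdd in \<open>auto simp: l_def intro: cInf_lower\<close>)
    fix y assume "l < y"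
    then obtain s0 where s0: "0 < s0" "s0 < t" "q s0 < y"
      using cInf_less_iff[OF _ bdd, of y] t by (auto simp: l_def)
    show "\<forall>\<^sub>F s in at_left t. q s < y"
      using eventually_at_left_real[OF s0(2)]
    proof eventually_elim
      case (elim s)
      then have "q s \<le> q s0"
        using concave_on_slopes(1)[OF conc S[OF s0(1,2)] t(2), of s] by (simp add: q_def)
      then show ?case using s0(3) by simp
    qed
  qed
  then have "(q \<longlongrightarrow> left_deriv G t) (at_left t)"
    unfolding left_deriv_def q by (metis tendsto_Lim trivial_limit_at_left_real)
  then show ?thesis unfolding q .
qed

lemma le_left_deriv:
  assumes conc: "concave_on (Ico0 \<eta>) G" and t: "0 < t" "t \<in> Ico0 \<eta>"
    and c: "\<And>s. \<lbrakk>0 < s; s < t\<rbrakk> \<Longrightarrow> c * (t - s) \<le> G t - G s"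
  shows "c \<le> left_deriv G t"
proof (rule tendsto_lowerbound[OF left_deriv_tendsto[OF conc t]])
  show "\<forall>\<^sub>F s in at_left t. c \<le> (G s - G t) / (s - t)"
    using eventually_at_left_real[OF t(1)]
  proof eventually_elim
    case (elim s)
    then have "c \<le> (G t - G s) / (t - s)" using c[of s] by (simp add: pos_le_divide_eq)
    then show ?case by (metis minus_diff_eq minus_divide_divide)
  qed
qed simp

lemma left_deriv_mult_le:
  assumes conc: "concave_on (Ico0 \<eta>) G" and t: "t \<in> Ico0 \<eta>" and s: "0 \<le> s" "s < t"
  shows "left_deriv G t * (t - s) \<le> G t - G s"
proof -
  have t0: "0 < t" using s by simp
  have "left_deriv G t \<le> (G t - G s) / (t - s)"
  proof (rule tendsto_upperbound[OF left_deriv_tendsto[OF conc t0 t]])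
    show "\<forall>\<^sub>F r in at_left t. (G r - G t) / (r - t) \<le> (G t - G s) / (t - s)"
      using eventually_at_left_real[OF s(2)]
    proof eventually_elim
      case (elim r)
      have "(G t - G r) / (t - r) \<le> (G t - G s) / (t - s)"
        using concave_on_slopes(1)[OF conc Ico0_mono[OF t s(1)] t, of r] elim s by auto
      then show ?case by (metis minus_diff_eq minus_divide_divide)
    qed
  qed simp
  then show ?thesis using s by (simp add: pos_le_divide_eq)
qed

lemma left_deriv_antimono:
  assumes conc: "concave_on (Ico0 \<eta>) G" and "0 < s" "s \<le> t" "t \<in> Ico0 \<eta>"
  shows "left_deriv G t \<le> left_deriv G s"
proof (cases "s = t")
  case False
  then have st: "s < t" using assms by simp
  have s: "s \<in> Ico0 \<eta>" using Ico0_mono[OF assms(4)] assms by simp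
  show ?thesis
  proof (rule le_left_deriv[OF conc assms(2) s])
    fix r assume r: "0 < r" "r < s"
    have "left_deriv G t \<le> (G t - G s) / (t - s)"
      using left_deriv_mult_le[OF conc assms(4) _ st] assms(2) st by (simp add: pos_le_divide_eq)
    also have "\<dots> \<le> (G s - G r) / (s - r)"
      using concave_on_slopes[OF conc Ico0_mono[OF s] assms(4), of r s] r st by linarith
    finally show "left_deriv G t * (s - r) \<le> G s - G r"
      using r by (simp add: pos_le_divide_eq)
  qed
qed simp

lemma left_deriv_pos:
  assumes conc: "concave_on (Ico0 \<eta>) G" and mono: "strict_mono_on (Ico0 \<eta>) G"
    and t: "0 < t" "t \<in> Ico0 \<eta>"
  shows "0 < left_deriv G t"
proof -
  obtain t' where t': "t < t'" "t' \<in> Ico0 \<eta>" using Ico0_open_right[OF t(2)] .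
  have "0 < (G t' - G t) / (t' - t)"
    using mono t t' by (auto simp: strict_mono_on_def)
  also have "\<dots> \<le> left_deriv G t"
  proof (rule le_left_deriv[OF conc t])
    fix s assume s: "0 < s" "s < t"
    have "(G t' - G t) / (t' - t) \<le> (G t - G s) / (t - s)"
      using concave_on_slopes[OF conc Ico0_mono[OF t(2)] t'(2), of s t] s t' by linarith
    then show "(G t' - G t) / (t' - t) * (t - s) \<le> G t - G s"
      using s by (simp add: pos_le_divide_eq)
  qed
  finally show ?thesis .
qed

section \<open>Integrals of positive decreasing functions\<close>

definition integral_from_0 :: "(real \<Rightarrow> real) \<Rightarrow> real \<Rightarrow> ennreal" where
  "integral_from_0 h t = (\<integral>\<^sup>+s\<in>{0<..<t}. ennreal (h s) \<partial>lborel)"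

text \<open>Here \<open>G\<close> is a function whose backward slopes at \<open>t\<close> all dominate \<open>h t\<close>. Put
  \<open>a k = t / 2 ^ (k + 1)\<close>. On \<open>{a k<..2 * a k}\<close> the function \<open>h\<close> is at most \<open>h (a k)\<close>, so its integral
  there is at most \<open>h (a k) * a k\<close>. The hypothesis on \<open>G\<close>, applied one dyadic step further left,
  bounds this by \<open>2 * (G (a k) - G (a (k + 1)))\<close>, and the sum telescopes.\<close>

lemma integral_from_0_le:
  assumes anti: "\<And>s t. \<lbrakk>0 < s; s \<le> t; t \<in> Ico0 \<eta>\<rbrakk> \<Longrightarrow> h t \<le> h s"
    and pos: "\<And>t. \<lbrakk>0 < t; t \<in> Ico0 \<eta>\<rbrakk> \<Longrightarrow> 0 \<le> h t"
    and G: "\<And>s t. \<lbrakk>0 \<le> s; s < t; t \<in> Ico0 \<eta>\<rbrakk> \<Longrightarrow> h t * (t - s) \<le> G t - G s"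
    and G0: "\<And>t. t \<in> Ico0 \<eta> \<Longrightarrow> 0 \<le> G t"
    and t: "0 < t" "t \<in> Ico0 \<eta>"
  shows "integral_from_0 h t \<le> ennreal (2 * G t)"
proof -
  define a where "a k = t / 2 ^ Suc k" for k :: nat
  have a: "0 < a k" "a k \<le> t" "a k \<in> Ico0 \<eta>" "a (Suc k) = a k / 2" for k
  proof -
    show *: "0 < a k" using t by (simp add: a_def)
    have "(1::real) \<le> 2 ^ Suc k" by (rule one_le_power) simp
    then show "a k \<le> t" using t unfolding a_def by (simp add: divide_le_eq mult_le_cancel_left1 del: power_Suc)
    then show "a k \<in> Ico0 \<eta>" using Ico0_mono[OF t(2)] * by simp
    show "a (Suc k) = a k / 2" by (simp add: a_def)
  qed
  let ?A = "\<lambda>k. {a k<..2 * a k}"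
  have cover: "ennreal (h s) * indicator {0<..<t} s
      \<le> (\<Sum>k. ennreal (h (a k)) * indicator (?A k) s)" for s
  proof (cases "s \<in> {0<..<t}")
    case True
    have "\<exists>k. a k < s"
    proof -
      obtain n where "(1/2) ^ n < s / t"
        using real_arch_pow_inv[of "s / t" "1/2"] True by auto
      then have "t / 2 ^ n < s" using t by (simp add: field_simps power_one_over)
      moreover have "a n \<le> t / 2 ^ n" using t by (simp add: a_def field_simps)
      ultimately show ?thesis by (intro exI[of _ n]) simp
    qed
    \<comment> \<open>The least such index names the dyadic interval that contains \<open>s\<close>.\<close>
    define k where "k = (LEAST k. a k < s)"
    have k: "a k < s" unfolding k_def using \<open>\<exists>k. a k < s\<close> by (rule LeastI_ex)
    have "s \<le> 2 * a k"
    proof (cases k)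
      case 0
      then show ?thesis using True by (simp add: a_def)
    next
      case (Suc j)
      then have "\<not> a j < s" using not_less_Least[of j "\<lambda>k. a k < s"] by (simp add: k_def)
      then show ?thesis using a(4)[of j] Suc by simp
    qed
    have "s \<in> Ico0 \<eta>" using Ico0_mono[OF t(2)] True by simp
    then have "ennreal (h s) \<le> ennreal (h (a k)) * indicator (?A k) s"
      using k \<open>s \<le> 2 * a k\<close> anti[of "a k" s] a(1)[of k] by (auto intro: ennreal_leI)
    also have "\<dots> \<le> (\<Sum>k. ennreal (h (a k)) * indicator (?A k) s)"
    proof -
      define e where "e j = ennreal (h (a j)) * indicator (?A j) s" for j
      have "sum e {k} \<le> suminf e" by (rule sum_le_suminf) auto
      then have "e k \<le> suminf e" by simp
      then show ?thesis unfolding e_def .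
    qed

    finally show ?thesis using True by simp
  qed simp
  have "integral_from_0 h t \<le> (\<integral>\<^sup>+s. (\<Sum>k. ennreal (h (a k)) * indicator (?A k) s) \<partial>lborel)"
    unfolding integral_from_0_def by (intro nn_integral_mono cover)
  also have "\<dots> = (\<Sum>k. \<integral>\<^sup>+s. ennreal (h (a k)) * indicator (?A k) s \<partial>lborel)"
    by (rule nn_integral_suminf) auto
  also have "\<dots> = (\<Sum>k. ennreal (h (a k) * a k))"
    using a pos less_imp_le[OF a(1)]
    by (subst nn_integral_cmult_indicator) (auto simp: ennreal_mult)
  also have "\<dots> \<le> (\<Sum>k. ennreal (2 * (G (a k) - G (a (Suc k)))))"
  proof (intro suminf_le ennreal_leI)
    fix k
    show "h (a k) * a k \<le> 2 * (G (a k) - G (a (Suc k)))"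
    proof -
      have "h (a k) * (a k - a (Suc k)) \<le> G (a k) - G (a (Suc k))"
        using a[of k] a(1)[of "Suc k"] by (intro G) auto
      moreover have "a k - a (Suc k) = a k / 2" using a(4)[of k] by simp
      ultimately show ?thesis by simp
    qed
  qed auto
  also have "\<dots> \<le> ennreal (2 * G t)"
  proof (rule suminf_le_const)
    fix n
    have step: "0 \<le> G (a k) - G (a (Suc k))" for k
    proof -
      have "0 \<le> h (a k) * (a k - a (Suc k))"
        using a[of k] pos[of "a k"] by simp
      also have "\<dots> \<le> G (a k) - G (a (Suc k))"
        using a[of k] a(1)[of "Suc k"] by (intro G) auto
      finally show ?thesis .
    qed
    have top: "G (a 0) \<le> G t"
    proof -
      have "0 \<le> h t * (t - a 0)" using t pos[of t] a(2)[of 0] by simp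
      then show ?thesis using G[of "a 0" t] t by (simp add: a_def)
    qed
    have "(\<Sum>k<n. ennreal (2 * (G (a k) - G (a (Suc k)))))
        = ennreal (\<Sum>k<n. 2 * (G (a k) - G (a (Suc k))))"
      using step by (intro sum_ennreal) simp
    also have "\<dots> = ennreal (2 * (G (a 0) - G (a n)))"
      by (simp only: sum_distrib_left[symmetric] sum_lessThan_telescope'[of "\<lambda>k. G (a k)"])
    also have "\<dots> \<le> ennreal (2 * G t)"
      using top G0[OF a(3)[of n]] by (intro ennreal_leI) simp
    finally show "(\<Sum>k<n. ennreal (2 * (G (a k) - G (a (Suc k))))) \<le> ennreal (2 * G t)" .
  qed auto
  finally show ?thesis .
qed

lemma borel_measurable_antimono_indicator:
  fixes h :: "real \<Rightarrow> real"
  assumes "\<And>r s. \<lbrakk>r \<in> A; s \<in> A; r \<le> s\<rbrakk> \<Longrightarrow> h s \<le> h r" and "A \<in> sets borel"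
  shows "(\<lambda>s. ennreal (h s) * indicator A s) \<in> borel_measurable borel"
proof -
  have "mono_on A (\<lambda>s. - h s)" using assms(1) by (auto intro!: mono_onI)
  from borel_measurable_uminus[OF borel_measurable_mono_on_fnc[OF this]]
  have "h \<in> borel_measurable (restrict_space borel A)" by simp
  then have "(\<lambda>s. ennreal (h s)) \<in> borel_measurable (restrict_space borel A)"
    by measurable
  then show ?thesis
    using assms(2) by (subst (asm) borel_measurable_restrict_space_iff_ennreal) auto
qed

lemma integral_from_0_increment:
  assumes anti: "\<And>s t. \<lbrakk>0 < s; s \<le> t; t \<in> Ico0 \<eta>\<rbrakk> \<Longrightarrow> h t \<le> h s"
    and st: "0 \<le> s" "s < t" "t \<in> Ico0 \<eta>"
    and fin: "integral_from_0 h t < \<infinity>" and ht: "0 \<le> h t"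
  shows "h t * (t - s) \<le> enn2real (integral_from_0 h t) - enn2real (integral_from_0 h s)"
    and "0 < s \<Longrightarrow> enn2real (integral_from_0 h t) - enn2real (integral_from_0 h s) \<le> h s * (t - s)"
proof -
  have I: "r \<in> Ico0 \<eta>" if "0 \<le> r" "r \<le> t" for r using Ico0_mono[OF st(3)] that by simp
  have [measurable]: "(\<lambda>r. ennreal (h r) * indicator {0<..<s} r) \<in> borel_measurable borel"
    using anti I st by (intro borel_measurable_antimono_indicator) auto
  have le: "integral_from_0 h s \<le> integral_from_0 h t"
    unfolding integral_from_0_def using st
    by (intro nn_integral_mono) (auto split: split_indicator)
  have *: "(\<integral>\<^sup>+r. ennreal (h r) * indicator {0<..<s} r + ennreal c * indicator B r \<partial>lborel)
      = integral_from_0 h s + ennreal (c * (t - s))"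
    if "emeasure lborel B = ennreal (t - s)" "B \<in> sets borel" "0 \<le> c" for c B
    using that st unfolding integral_from_0_def
    by (subst nn_integral_add) (auto simp: nn_integral_cmult_indicator ennreal_mult)
  obtain x where x: "integral_from_0 h s = ennreal x" "0 \<le> x"
    using le fin by (cases "integral_from_0 h s") (auto simp: top_unique)
  obtain y where y: "integral_from_0 h t = ennreal y" "0 \<le> y"
    using fin by (cases "integral_from_0 h t") auto
  have "integral_from_0 h s + ennreal (h t * (t - s))
      = (\<integral>\<^sup>+r. ennreal (h r) * indicator {0<..<s} r + ennreal (h t) * indicator {s<..<t} r \<partial>lborel)"
    using st ht by (subst *) auto
  also have "\<dots> \<le> integral_from_0 h t"
    unfolding integral_from_0_def
    by (intro nn_integral_mono) (use anti st in \<open>auto split: split_indicator intro: ennreal_leI\<close>)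
  finally show "h t * (t - s) \<le> enn2real (integral_from_0 h t) - enn2real (integral_from_0 h s)"
    using x y ht st by (simp add: ennreal_plus[symmetric] del: ennreal_plus)
  assume s: "0 < s"
  have hs: "0 \<le> h s" using anti[OF s _ st(3)] st ht by simp
  have "integral_from_0 h t
      \<le> (\<integral>\<^sup>+r. ennreal (h r) * indicator {0<..<s} r + ennreal (h s) * indicator {s..<t} r \<partial>lborel)"
    unfolding integral_from_0_def
    by (intro nn_integral_mono) (use anti I s in \<open>auto split: split_indicator intro: ennreal_leI\<close>)
  also have "\<dots> = integral_from_0 h s + ennreal (h s * (t - s))"
    using st hs by (subst *) auto
  finally show "enn2real (integral_from_0 h t) - enn2real (integral_from_0 h s) \<le> h s * (t - s)"
    using x y hs st by (simp add: ennreal_plus[symmetric] del: ennreal_plus)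
qed

text \<open>Everything follows from the two bounds \<open>inc\<close> on the increments of \<open>F\<close>: a chord of \<open>F\<close> has
  slope at least the value of \<open>h\<close> at its right end and at most the value at its left end. Two
  adjacent chords are thus separated by the value of \<open>h\<close> at their common point, which is concavity.
  The majorant \<open>G\<close> serves for finiteness and for right-continuity at \<open>0\<close>.\<close>

lemma integral_from_0_concave_Phi:
  assumes \<eta>: "0 < \<eta>"
    and anti: "\<And>s t. \<lbrakk>0 < s; s \<le> t; t \<in> Ico0 \<eta>\<rbrakk> \<Longrightarrow> h t \<le> h s"
    and pos: "\<And>t. \<lbrakk>0 < t; t \<in> Ico0 \<eta>\<rbrakk> \<Longrightarrow> 0 < h t"
    and G: "\<And>s t. \<lbrakk>0 \<le> s; s < t; t \<in> Ico0 \<eta>\<rbrakk> \<Longrightarrow> h t * (t - s) \<le> G t - G s"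
    and G0: "\<And>t. t \<in> Ico0 \<eta> \<Longrightarrow> 0 \<le> G t" and Glim: "(G \<longlongrightarrow> 0) (at_right 0)"
    and F0: "F 0 = 0"
    and F: "\<And>t. \<lbrakk>0 < t; t \<in> Ico0 \<eta>\<rbrakk> \<Longrightarrow> F t = enn2real (integral_from_0 h t)"
  shows "F \<in> Phi_class \<eta>" and "concave_on (Ico0 \<eta>) F"
    and "\<And>t. \<lbrakk>0 < t; t \<in> Ico0 \<eta>\<rbrakk> \<Longrightarrow> h t \<le> left_deriv F t"
proof -
  have bound: "integral_from_0 h t \<le> ennreal (2 * G t)" if "0 < t" "t \<in> Ico0 \<eta>" for t
    using integral_from_0_le[of \<eta> h G t, OF anti _ G G0 that] pos less_imp_le by blast
  have F_eq: "F t = enn2real (integral_from_0 h t)" if "t \<in> Ico0 \<eta>" for t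
    using F[of t] that F0 by (cases "t = 0") (auto simp: Ico0_def integral_from_0_def)
  have nonneg: "0 \<le> F t" if "t \<in> Ico0 \<eta>" for t
    using F_eq[OF that] by simp
  have F_le: "F t \<le> 2 * G t" if "0 < t" "t \<in> Ico0 \<eta>" for t
    using bound[OF that] that G0[of t] by (simp add: F enn2real_leI)
  have inc: "h t * (t - s) \<le> F t - F s" "0 < s \<Longrightarrow> F t - F s \<le> h s * (t - s)"
    if st: "0 \<le> s" "s < t" "t \<in> Ico0 \<eta>" for s t
  proof -
    have t: "0 < t" using st by simp
    have fin: "integral_from_0 h t < \<infinity>"
      using bound[OF t st(3)] by (auto intro: le_less_trans)
    have s: "s \<in> Ico0 \<eta>" using Ico0_mono[OF st(3)] st by simp
    note I = integral_from_0_increment[of \<eta> h s t, OF anti st fin less_imp_le[OF pos[OF t st(3)]]]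
    show "h t * (t - s) \<le> F t - F s" "0 < s \<Longrightarrow> F t - F s \<le> h s * (t - s)"
      using I F_eq[OF s] F_eq[OF st(3)] by simp_all
  qed
  have "strict_mono_on (Ico0 \<eta>) F"
  proof (rule strict_mono_onI)
    fix s t assume "s \<in> Ico0 \<eta>" "t \<in> Ico0 \<eta>" "s < t"
    then have "0 \<le> s" "0 < h t * (t - s)" using pos[of t] by (auto simp: Ico0_def)
    then show "F s < F t" using inc(1)[of s t] \<open>s < t\<close> \<open>t \<in> Ico0 \<eta>\<close> by linarith
  qed
  moreover have "(F \<longlongrightarrow> F 0) (at_right 0)"
  proof -
    obtain b where b: "0 < b" "b \<in> Ico0 \<eta>"
      using Ico0_open_right[of 0 \<eta>] \<eta> by (auto simp: Ico0_def zero_ereal_def)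
    have ev: "\<forall>\<^sub>F t in at_right 0. t \<in> {0<..<b}" by (rule eventually_at_right_real[OF b(1)])
    have "((\<lambda>t. 2 * G t) \<longlongrightarrow> 0) (at_right 0)" using tendsto_mult_right_zero[OF Glim] .
    moreover have "\<forall>\<^sub>F t in at_right 0. 0 \<le> F t" "\<forall>\<^sub>F t in at_right 0. F t \<le> 2 * G t"
      using ev by (eventually_elim, use nonneg F_le Ico0_mono[OF b(2)] in auto)+
    ultimately have "(F \<longlongrightarrow> 0) (at_right 0)"
      by (intro real_tendsto_sandwich[of "\<lambda>_. 0" F _ "\<lambda>t. 2 * G t"]) auto
    then show ?thesis by (simp add: F0)
  qed
  ultimately show "F \<in> Phi_class \<eta>"
    using nonneg F0 by (simp add: Phi_class_def)
  show conc: "concave_on (Ico0 \<eta>) F"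
  proof (rule concave_on_realI[OF convex_Ico0])
    fix a b c assume abc: "a \<in> Ico0 \<eta>" "b \<in> Ico0 \<eta>" "c \<in> Ico0 \<eta>" "a < b" "b < c"
    then have a: "0 \<le> a" by (simp add: Ico0_def)
    have "(F c - F b) * (b - a) \<le> (h b * (c - b)) * (b - a)"
      using inc(2)[of b c] abc a by (intro mult_right_mono) auto
    also have "\<dots> = (h b * (b - a)) * (c - b)" by simp
    also have "\<dots> \<le> (F b - F a) * (c - b)"
      using inc(1)[of a b] abc a by (intro mult_right_mono) auto
    finally show "(F c - F b) * (b - a) \<le> (F b - F a) * (c - b)" .
  qed
  show "h t \<le> left_deriv F t" if "0 < t" "t \<in> Ico0 \<eta>" for t
    using le_left_deriv[OF conc that] inc(1) that by simp
qed

section \<open>The Kurdyka-Lojasiewicz property of a minimum\<close>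

text \<open>A level strictly between \<open>f a\<close> and \<open>g i a\<close> separates \<open>f\<close> from a piece inactive at \<open>a\<close>. Upper
  bounds on \<open>f\<close> near \<open>a\<close> come only from continuity along \<open>dom_subdiff f\<close>, hence the restriction
  on \<open>x\<close>.\<close>

lemma eventually_active_subset:
  assumes J: "finite J" "J \<noteq> {}" and lsc: "\<And>i. i \<in> J \<Longrightarrow> lsc_fun (g i)"
    and f: "\<And>x. f x = (MIN i\<in>J. g i x)"
    and cont: "continuous_on (dom_subdiff f) f" and a: "a \<in> dom_subdiff f"
  shows "\<forall>\<^sub>F x in nhds a. x \<in> dom_subdiff f \<longrightarrow> (\<forall>i\<in>J. g i x = f x \<longrightarrow> g i a = f a)"
proof -
  have "\<forall>\<^sub>F x in nhds a. x \<in> dom_subdiff f \<longrightarrow> g i x = f x \<longrightarrow> g i a = f a" if i: "i \<in> J" for i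
  proof (cases "g i a = f a")
    case False
    have "f a \<le> g i a" using i J by (simp add: f)
    then obtain d where d: "f a < d" "d < g i a"
      using False by (metis dense order_le_less)
    have "(f \<longlongrightarrow> f a) (at a within dom_subdiff f)"
      using cont a by (simp add: continuous_on_def)
    then have "\<forall>\<^sub>F x in at a within dom_subdiff f. f x < d"
      using d(1) by (rule order_tendstoD)
    then have "\<forall>\<^sub>F x in nhds a. x \<in> dom_subdiff f \<longrightarrow> f x < d"
      unfolding eventually_at_filter by eventually_elim (use d(1) in metis)
    moreover have "\<forall>\<^sub>F x in nhds a. d < g i x"
      using lsc[OF i] d(2) by (simp add: lsc_fun_iff)
    ultimately show ?thesis by eventually_elim auto
  qed simp
  then have "\<forall>\<^sub>F x in nhds a. \<forall>i\<in>J. x \<in> dom_subdiff f \<longrightarrow> g i x = f x \<longrightarrow> g i a = f a"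
    using J(1) by (intro eventually_ball_finite) auto
  then show ?thesis by eventually_elim blast
qed

theorem theorem3p6:
  fixes m :: nat
    and fi :: "nat \<Rightarrow> real ^ 'n \<Rightarrow> ereal"
    and f :: "real ^ 'n \<Rightarrow> ereal"
    and xbar :: "real ^ 'n"
    and I :: "nat set"
    and \<epsilon>i :: "nat \<Rightarrow> real"
    and \<eta>i :: "nat \<Rightarrow> ereal"
    and \<phi>i :: "nat \<Rightarrow> real \<Rightarrow> real"
    and \<eta> :: ereal
    and \<phi> :: "real \<Rightarrow> ereal"
  assumes "1 \<le> m"
    and "\<And>i. i \<in> {1..m} \<Longrightarrow> proper_fun (fi i)"
    and "\<And>i. i \<in> {1..m} \<Longrightarrow> lsc_fun (fi i)"
    and "\<And>x. f x = (MIN i\<in>{1..m}. fi i x)"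
    and "continuous_on (dom_subdiff f) f"
    and "xbar \<in> dom_subdiff f"
    and "I = {i\<in>{1..m}. fi i xbar = f xbar}"
    and "xbar \<in> (\<Inter>i\<in>I. dom_subdiff (fi i))"
    and "\<And>i. i \<in> I \<Longrightarrow> 0 < \<epsilon>i i"
    and "\<And>i. i \<in> I \<Longrightarrow> 0 < \<eta>i i"
    and "\<And>i. i \<in> I \<Longrightarrow> gen_concave_KL (fi i) xbar (ball xbar (\<epsilon>i i)) (\<eta>i i) (\<phi>i i)"
    and "\<eta> = (MIN i\<in>I. \<eta>i i)"
    and "\<phi> 0 = 0"
    and "\<And>t. 0 < t \<Longrightarrow> ereal t < \<eta> \<Longrightarrow>
           \<phi> t = enn2ereal (\<integral>\<^sup>+s\<in>{0<..<t}. ennreal (MAX i\<in>I. left_deriv (\<phi>i i) s) \<partial>lborel)"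
  shows "(\<forall>t\<in>Ico0 \<eta>. \<phi> t < \<infinity>) \<and>
         (\<exists>\<epsilon>>0. gen_concave_KL f xbar (ball xbar \<epsilon>) \<eta> (\<lambda>t. real_of_ereal (\<phi> t)))"
proof -
  note proper = assms(2) and lsc = assms(3) and f_Min = assms(4) and KL = assms(11)
  have J: "finite {1..m}" "{1..m} \<noteq> {}" using assms(1) by auto
  have finI: "finite I" using assms(7) by simp
  have neI: "I \<noteq> {}"
  proof -
    have "f xbar \<in> (\<lambda>i. fi i xbar) ` {1..m}" unfolding f_Min using J by (intro Min_in) auto
    then show ?thesis by (auto simp: assms(7))
  qed
  have I: "i \<in> {1..m}" "fi i xbar = f xbar" if "i \<in> I" for i using that assms(7) by auto
  have \<eta>0: "0 < \<eta>" using assms(10,12) finI neI by simp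
  have \<eta>_le: "\<eta> \<le> \<eta>i i" if "i \<in> I" for i using that finI assms(12) by simp
  have Ico: "t \<in> Ico0 (\<eta>i i)" if "t \<in> Ico0 \<eta>" "i \<in> I" for t i
    using \<eta>_le[OF that(2)] that(1) by (auto simp: Ico0_def)
  have conc: "concave_on (Ico0 (\<eta>i i)) (\<phi>i i)" and Phi: "\<phi>i i \<in> Phi_class (\<eta>i i)"
    and ineq: "\<And>x. \<lbrakk>x \<in> ball xbar (\<epsilon>i i); 0 < fi i x - fi i xbar; fi i x - fi i xbar < \<eta>i i\<rbrakk> \<Longrightarrow>
        1 \<le> ereal (left_deriv (\<phi>i i) (real_of_ereal (fi i x - fi i xbar)))
            * edist_set 0 (limiting_subdiff (fi i) x)" if "i \<in> I" for i
    using KL[OF that] by (auto simp: gen_concave_KL_def)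

  define h where "h s = (MAX i\<in>I. left_deriv (\<phi>i i) s)" for s
  define G where "G t = (\<Sum>i\<in>I. \<phi>i i t)" for t
  define F where "F t = real_of_ereal (\<phi> t)" for t
  have h_ge: "left_deriv (\<phi>i i) s \<le> h s" if "i \<in> I" for i s
    using that finI by (simp add: h_def)
  have h_ex: "\<exists>i\<in>I. h s = left_deriv (\<phi>i i) s" for s
  proof -
    have "h s \<in> (\<lambda>i. left_deriv (\<phi>i i) s) ` I"
      unfolding h_def using finI neI by (intro Max_in) auto
    then show ?thesis by blast
  qed
  have h_pos: "0 < h t" if "0 < t" "t \<in> Ico0 \<eta>" for t
    using h_ex[of t] left_deriv_pos[OF conc _ that(1) Ico[OF that(2)]] Phi
    by (auto simp: Phi_class_def)
  have h_anti: "h t \<le> h s" if "0 < s" "s \<le> t" "t \<in> Ico0 \<eta>" for s t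
  proof -
    obtain i where i: "i \<in> I" "h t = left_deriv (\<phi>i i) t" using h_ex by blast
    show ?thesis
      using left_deriv_antimono[OF conc[OF i(1)] that(1,2) Ico[OF that(3) i(1)]]
        i(2) h_ge[OF i(1), of s] by simp
  qed
  \<comment> \<open>The backward slope of the sum dominates \<open>h t\<close>: the maximum is attained by one summand, and
    the increments of the other summands are nonnegative.\<close>
  have hG: "h t * (t - s) \<le> G t - G s" if st: "0 \<le> s" "s < t" "t \<in> Ico0 \<eta>" for s t
  proof -
    obtain i where i: "i \<in> I" "h t = left_deriv (\<phi>i i) t" using h_ex by blast
    have "h t * (t - s) \<le> \<phi>i i t - \<phi>i i s"
      using left_deriv_mult_le[OF conc Ico st(1,2)] i st(3) by simp
    also have "\<dots> \<le> (\<Sum>j\<in>I. \<phi>i j t - \<phi>i j s)"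
    proof (rule member_le_sum[OF i(1) _ finI])
      fix j assume j: "j \<in> I - {i}"
      then have "strict_mono_on (Ico0 (\<eta>i j)) (\<phi>i j)" using Phi by (auto simp: Phi_class_def)
      moreover have "s \<in> Ico0 (\<eta>i j)" "t \<in> Ico0 (\<eta>i j)"
        using Ico j st Ico0_mono[OF st(3), of s] by auto
      ultimately show "0 \<le> \<phi>i j t - \<phi>i j s"
        using st(2) by (auto simp: strict_mono_on_def less_imp_le)
    qed
    finally show ?thesis by (simp add: G_def sum_subtractf)
  qed
  have G0: "0 \<le> G t" if "t \<in> Ico0 \<eta>" for t
    unfolding G_def using Phi Ico[OF that] by (intro sum_nonneg) (auto simp: Phi_class_def)
  have Glim: "(G \<longlongrightarrow> 0) (at_right 0)"
    unfolding G_def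
  proof (rule tendsto_null_sum)
    fix i assume "i \<in> I"
    from Phi[OF this] show "(\<phi>i i \<longlongrightarrow> 0) (at_right 0)" by (auto simp: Phi_class_def)
  qed
  have \<phi>: "\<phi> t = enn2ereal (integral_from_0 h t)" if "0 < t" "t \<in> Ico0 \<eta>" for t
    using assms(14)[of t] that by (simp add: Ico0_def integral_from_0_def h_def)
  have F: "F t = enn2real (integral_from_0 h t)" if "0 < t" "t \<in> Ico0 \<eta>" for t
    using \<phi>[OF that] by (simp add: F_def)
  have F0: "F 0 = 0" using assms(13) by (simp add: F_def)
  note facts = \<eta>0 h_anti h_pos hG G0 Glim F0 F
  have F_Phi: "F \<in> Phi_class \<eta>" and F_conc: "concave_on (Ico0 \<eta>) F"
    by (rule integral_from_0_concave_Phi(1,2)[of \<eta> h G]; fact facts)+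
  have F_deriv: "h t \<le> left_deriv F t" if "0 < t" "t \<in> Ico0 \<eta>" for t
    by (rule integral_from_0_concave_Phi(3)[of \<eta> h G]; fact facts that)

  have fin: "\<phi> t < \<infinity>" if "t \<in> Ico0 \<eta>" for t
  proof (cases "t = 0")
    case False
    then have t: "0 < t" using that by (simp add: Ico0_def)
    have "integral_from_0 h t \<le> ennreal (2 * G t)"
      using integral_from_0_le[of \<eta> h G t, OF h_anti _ hG G0 t that] h_pos less_imp_le by blast
    then have "integral_from_0 h t < \<infinity>" by (auto intro: le_less_trans)
    then show ?thesis using \<phi>[OF t that]
      by (cases "integral_from_0 h t") auto
  qed (simp add: assms(13))

  have f_proper: "proper_fun f"
  proof -
    have noninf: "f x \<noteq> - \<infinity>" for x
    proof -
      have "f x \<in> (\<lambda>i. fi i x) ` {1..m}" unfolding f_Min using J by (intro Min_in) auto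
      then obtain i where "i \<in> {1..m}" "f x = fi i x" by blast
      then show ?thesis using proper[of i] by (simp add: proper_fun_def)
    qed
    obtain x where "fi 1 x < \<infinity>"
      using proper[of 1] assms(1) by (auto simp: proper_fun_def edom_def)
    moreover have "f x \<le> fi 1 x" unfolding f_Min using assms(1) by (intro Min_le) auto
    ultimately have "x \<in> edom f" by (auto simp: edom_def)
    then show ?thesis using noninf by (auto simp: proper_fun_def)
  qed
  have f_lsc: "lsc_fun f"
    using lsc_fun_Min[OF J lsc] f_Min by (simp add: ext[of f, OF f_Min])
  have "\<forall>\<^sub>F x in nhds xbar. x \<in> dom_subdiff f \<longrightarrow> (\<forall>i\<in>{1..m}. fi i x = f x \<longrightarrow> i \<in> I)"
    using eventually_active_subset[OF J lsc f_Min assms(5,6)] assms(7) by simp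
  moreover have "\<forall>\<^sub>F x in nhds xbar. \<forall>i\<in>I. x \<in> ball xbar (\<epsilon>i i)"
    using finI assms(9) by (intro eventually_ball_finite ballI eventually_nhds_in_open) auto
  ultimately have "\<forall>\<^sub>F x in nhds xbar. (x \<in> dom_subdiff f \<longrightarrow> (\<forall>i\<in>{1..m}. fi i x = f x \<longrightarrow> i \<in> I))
      \<and> (\<forall>i\<in>I. x \<in> ball xbar (\<epsilon>i i))"
    by (rule eventually_conj)
  then obtain \<epsilon> where \<epsilon>: "0 < \<epsilon>"
    and act: "\<And>x i. \<lbrakk>x \<in> ball xbar \<epsilon>; x \<in> dom_subdiff f; i \<in> {1..m}; fi i x = f x\<rbrakk> \<Longrightarrow> i \<in> I"
    and sub: "\<And>x i. \<lbrakk>x \<in> ball xbar \<epsilon>; i \<in> I\<rbrakk> \<Longrightarrow> x \<in> ball xbar (\<epsilon>i i)"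
    unfolding eventually_nhds_metric by (metis dist_commute mem_ball)
  have "1 \<le> ereal (left_deriv F (real_of_ereal (f x - f xbar))) * edist_set 0 (limiting_subdiff f x)"
    if x: "x \<in> ball xbar \<epsilon>" "0 < f x - f xbar" "f x - f xbar < \<eta>" for x
  proof -
    define t where "t = real_of_ereal (f x - f xbar)"
    have t_eq: "f x - f xbar = ereal t"
      using x(2,3) by (cases "f x - f xbar") (auto simp: t_def)
    then have t: "0 < t" "t \<in> Ico0 \<eta>" using x by (auto simp: Ico0_def zero_ereal_def)
    have "1 \<le> ereal (left_deriv F t) * edist_set 0 (limiting_subdiff f x)"
    proof (rule one_le_mult_edist_set)
      show "0 < left_deriv F t" using F_deriv[OF t] h_pos[OF t] by simp
      \<comment> \<open>A subgradient at \<open>x\<close> puts \<open>x\<close> in \<open>dom_subdiff f\<close>, so the pieces active at \<open>x\<close> lie in \<open>I\<close>.\<close>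
      fix u assume u: "u \<in> limiting_subdiff f x"
      then obtain i where i: "i \<in> {1..m}" "fi i x = f x" "u \<in> limiting_subdiff (fi i) x"
        using limiting_subdiff_Min[OF J lsc f_Min, of u x] by blast
      have iI: "i \<in> I" using act[OF x(1) _ i(1,2)] u by (auto simp: dom_subdiff_def)
      have diff: "fi i x - fi i xbar = ereal t" using i(2) I(2)[OF iI] t_eq by simp
      have Lpos: "0 < left_deriv (\<phi>i i) t"
        using left_deriv_pos[OF conc[OF iI] _ t(1) Ico[OF t(2) iI]] Phi[OF iI]
        by (simp add: Phi_class_def)
      have "1 \<le> ereal (left_deriv (\<phi>i i) t) * edist_set 0 (limiting_subdiff (fi i) x)"
        using ineq[OF iI sub[OF x(1) iI]] Ico[OF t(2) iI] t(1)
        by (simp add: diff Ico0_def)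
      also have "\<dots> \<le> ereal (left_deriv (\<phi>i i) t) * ereal (norm (0 - u))"
        using Lpos edist_set_le[OF i(3), of 0] by (intro ereal_mult_left_mono) auto
      finally have "1 \<le> left_deriv (\<phi>i i) t * norm (0 - u)" by (simp add: one_ereal_def)
      also have "\<dots> \<le> left_deriv F t * norm (0 - u)"
        using h_ge[OF iI, of t] F_deriv[OF t] by (intro mult_right_mono) auto
      finally show "1 \<le> left_deriv F t * norm (0 - u)" .
    qed
    then show ?thesis by (simp add: t_def)
  qed
  then have "gen_concave_KL f xbar (ball xbar \<epsilon>) \<eta> F"
    using f_proper f_lsc assms(6) \<epsilon> \<eta>0 F_Phi F_conc by (simp add: gen_concave_KL_def)
  then show ?thesis using fin \<epsilon> unfolding F_def[abs_def] by blast
qed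

end
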